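(* Let $\lambda\in(0,1)$ and $d\in(0,1-\lambda)$. Let $\rho\in(0,1)$, $\alpha\in[0,1]$ and choose $\delta\in[\delta(\rho^-,\alpha),\delta(\rho,\alpha)]$. If $\rho\notin\mathbb{Q}$, then for every $a\in[a(\delta,\rho^+,\alpha),a(\delta,\rho,\alpha)]$ the couple $(\delta,a)$ belongs to $M_1$ if $\alpha\in[0,1-\rho)$, to $M_2$ if $\alpha=1-\rho$ and to $M_3$ if $\alpha\in(1-\rho,1]$. If $\rho\in\mathbb{Q}$, then there exists $a\in[a(\delta,\rho^+,\alpha),a(\delta,\rho,\alpha)]$ such that $(\delta,a)$ belongs to $M_1$ if $\alpha\in[0,1-\rho)$, to $M_2$ if $\alpha=1-\rho$ and to $M_3$ if $\alpha\in(1-\rho,1]$. Precisely, 1. If $\alpha\in[0,1-\rho)$, then $\delta\in(1-\lambda-d,1-d)$. Moreover, (a) For $\alpha\neq0$, $[a(\delta,\rho^+,\alpha),a(\delta,\rho,\alpha)]\subset[0,\eta_1]$, with $a(\delta,\rho^+,\alpha)=0$ only if $\rho\in\mathbb{Q}$ and $\delta=\delta(\rho^-,\alpha)$, and with $a(\delta,\rho,\alpha)=\eta_1$ only if $\rho\in\mathbb{Q}$ and $\delta=\delta(\rho,\alpha)$. (b) For $\alpha=0$, $a(\delta,\rho^+,\alpha)=a(\delta,\rho,\alpha)=0$ if $\rho\notin\mathbb{Q}$, and $a(\delta,\rho^+,\alpha)\le0\le a(\delta,\rho,\alpha)\le\eta_1$ if $\rho\in\mathbb{Q}$, where the last inequality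 is strict if $\delta\neq\delta(\rho,\alpha)$. 2. If $\alpha\in(1-\rho,1]$, then $\delta\in(1-\lambda,1)$. Moreover, (a) For $\alpha\neq1$, $[a(\delta,\rho^+,\alpha),a(\delta,\rho,\alpha)]\subset[\eta_2,1]$, with $a(\delta,\rho^+,\alpha)=\eta_2$ only if $\rho\in\mathbb{Q}$ and $\delta=\delta(\rho^-,\alpha)$, and with $a(\delta,\rho,\alpha)=1$ only if $\rho\in\mathbb{Q}$ and $\delta=\delta(\rho,\alpha)$. (b) For $\alpha=1$, $a(\delta,\rho^+,\alpha)=a(\delta,\rho,\alpha)=1$ if $\rho\notin\mathbb{Q}$, and $\eta_2\le a(\delta,\rho^+,\alpha)\le1\le a(\delta,\rho,\alpha)$ if $\rho\in\mathbb{Q}$, where the first inequality is strict if $\delta\neq\delta(\rho^-,\alpha)$ and the second one if $\delta\neq\delta(\rho,\alpha)$. 3. If $\alpha=1-\rho$, then $\delta\in(1-\lambda-d,1)$. Moreover, $a(\delta,\rho^+,\alpha)=a(\delta,\rho,\alpha)\in[\eta_1,\eta_2]$ if $\rho\notin\mathbb{Q}$, and $[a(\delta,\rho^+,\alpha),a(\delta,\rho,\alpha)]\cap[\eta_1,\eta_2]\neq\emptyset$ if $\rho\in\mathbb{Q}$, with $a(\delta,\rho,\alpha)=\eta_1$ if and only if $\delta=\delta(\rho^-,\alpha)$ and $a(\delta,\rho^+,\alpha)=\eta_2$ if and only if $\delta=\delta(\rho,\alpha)$.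
   Context: Notation: $\lfloor x\rfloor$ is the integer part and $\{x\}=x-\lfloor x\rfloor$ the fractional part of $x\in\mathbb{R}$. For $c\in\mathbb{R}$, $\theta_c(z)=0$ if $z<c$ and $\theta_c(z)=1$ if $z\ge c$. For $\rho,\alpha\in[0,1]$ define $$\delta(\rho,\alpha)=1-\lambda-d+\frac{1-\lambda}{\lambda}\sum_{k=1}^{\infty}\lambda^k\left((1-\lambda)\lfloor k\rho\rfloor+d\,\theta_{1-\alpha}(\{k\rho\})\right),$$ $$a(\delta,\rho,\alpha)=\frac{\delta}{1-\lambda}+\frac1\lambda\sum_{k=1}^{\infty}\lambda^k\left((1-\lambda)\lfloor\alpha-k\rho\rfloor+d\,\theta_\alpha(\{\alpha-k\rho\})\right)\quad\forall\delta\in[0,1].$$ For $\rho\in(0,1)$, $\delta(\rho^-,\alpha)=\lim_{r\to\rho^-}\delta(r,\alpha)$ and $a(\delta,\rho^+,\alpha)=\lim_{r\to\rho^+}a(\delta,r,\alpha)$. For given $\delta$ set $\eta_1=\frac{1-\delta-d}{\lambda}$ and $\eta_2=\frac{1-\delta}{\lambda}$. The following sets partition $(1-\lambda-d,1)\times[0,1]$: $M_1=\{(\delta,a):\delta\in(1-\lambda-d,1-d),\ a\in[0,\eta_1)\}$, $M_2=\{(\delta,a):\delta\in(1-\lambda-d,1),\ a\in[0,1]\cap[\eta_1,\eta_2]\}$, $M_3=\{(\delta,a):\delta\in(1-\lambda,1),\ a\in(\eta_2,1]\}$. *)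

theory Defs
  imports "HOL-Analysis.Analysis"
begin

definition theta :: "real \<Rightarrow> real \<Rightarrow> real" where
  "theta c z = (if z < c then 0 else 1)"

text \<open>
  The sums over \<open>k \<ge> 1\<close> are written as series over \<open>k \<ge> 0\<close> with \<open>k\<close> replaced by \<open>Suc k\<close>.
  The functions are total, but are only of interest for \<open>rho\<close> and \<open>alpha\<close> in \<open>[0, 1]\<close>.
\<close>

definition delta_fun :: "real \<Rightarrow> real \<Rightarrow> real \<Rightarrow> real \<Rightarrow> real" where
  "delta_fun lam d rho alpha =
     1 - lam - d + (1 - lam) / lam *
       (\<Sum>k. lam ^ Suc k *
          ((1 - lam) * of_int \<lfloor>real (Suc k) * rho\<rfloor>
             + d * theta (1 - alpha) (frac (real (Suc k) * rho))))"

definition a_fun :: "real \<Rightarrow> real \<Rightarrow> real \<Rightarrow> real \<Rightarrow> real \<Rightarrow> real" where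
  "a_fun lam d delta rho alpha =
     delta / (1 - lam) + 1 / lam *
       (\<Sum>k. lam ^ Suc k *
          ((1 - lam) * of_int \<lfloor>alpha - real (Suc k) * rho\<rfloor>
             + d * theta alpha (frac (alpha - real (Suc k) * rho))))"

text \<open>
  One-sided limits in \<open>rho\<close>, with \<open>alpha\<close> (and \<open>delta\<close>) kept fixed. That the limits exist is proved in
  \<open>delta_fun_tendsto_left\<close> and \<open>a_fun_tendsto_right\<close> below.
\<close>

definition delta_left :: "real \<Rightarrow> real \<Rightarrow> real \<Rightarrow> real \<Rightarrow> real" where
  "delta_left lam d rho alpha = Lim (at_left rho) (\<lambda>r. delta_fun lam d r alpha)"

definition a_right :: "real \<Rightarrow> real \<Rightarrow> real \<Rightarrow> real \<Rightarrow> real \<Rightarrow> real" where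
  "a_right lam d delta rho alpha = Lim (at_right rho) (\<lambda>r. a_fun lam d delta r alpha)"

definition eta1 :: "real \<Rightarrow> real \<Rightarrow> real \<Rightarrow> real" where
  "eta1 lam d delta = (1 - delta - d) / lam"

definition eta2 :: "real \<Rightarrow> real \<Rightarrow> real" where
  "eta2 lam delta = (1 - delta) / lam"

definition M1 :: "real \<Rightarrow> real \<Rightarrow> (real \<times> real) set" where
  "M1 lam d = {(delta, a). delta \<in> {1 - lam - d <..< 1 - d} \<and> a \<in> {0 ..< eta1 lam d delta}}"

definition M2 :: "real \<Rightarrow> real \<Rightarrow> (real \<times> real) set" where
  "M2 lam d = {(delta, a). delta \<in> {1 - lam - d <..< 1} \<and>
                 a \<in> {0..1} \<inter> {eta1 lam d delta .. eta2 lam delta}}"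

definition M3 :: "real \<Rightarrow> (real \<times> real) set" where
  "M3 lam = {(delta, a). delta \<in> {1 - lam <..< 1} \<and> a \<in> {eta2 lam delta <.. 1}}"


subsection \<open>Existence of the one-sided limits\<close>

lemma step_mono:
  fixes lam d c x y :: real
  assumes "0 \<le> d" "d \<le> 1 - lam" "x \<le> y"
  shows "(1 - lam) * of_int \<lfloor>x\<rfloor> + d * theta c (frac x)
           \<le> (1 - lam) * of_int \<lfloor>y\<rfloor> + d * theta c (frac y)"
proof (cases "\<lfloor>x\<rfloor> = \<lfloor>y\<rfloor>")
  case True
  then have "frac x \<le> frac y" using assms by (simp add: frac_def)
  then have "theta c (frac x) \<le> theta c (frac y)" by (simp add: theta_def)
  then show ?thesis using True assms by (simp add: mult_left_mono)
next
  case False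
  then have "\<lfloor>x\<rfloor> + 1 \<le> \<lfloor>y\<rfloor>" using floor_mono[OF assms(3)] by linarith
  then have "real_of_int \<lfloor>x\<rfloor> + 1 \<le> of_int \<lfloor>y\<rfloor>" by linarith
  then have "(1 - lam) * (real_of_int \<lfloor>x\<rfloor> + 1) \<le> (1 - lam) * of_int \<lfloor>y\<rfloor>"
    using assms by (intro mult_left_mono) auto
  moreover have "d * theta c (frac x) \<le> d" "0 \<le> d * theta c (frac y)"
    using assms by (auto simp: theta_def)
  ultimately show ?thesis using assms(2) by (simp add: algebra_simps)
qed

lemma step_summable:
  fixes lam d c b r :: real
  assumes "0 < lam" "lam < 1"
  shows "summable (\<lambda>k. lam ^ Suc k *
           ((1 - lam) * of_int \<lfloor>b + real (Suc k) * r\<rfloor> + d * theta c (frac (b + real (Suc k) * r))))"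
    (is "summable (\<lambda>k. lam ^ Suc k * ?s k)")
proof (rule summable_comparison_test')
  let ?C = "(1 - lam) * (\<bar>b\<bar> + \<bar>r\<bar> + 1) + \<bar>d\<bar>"
  have "summable (\<lambda>k. of_nat (Suc k) * lam ^ k)"
    using geometric_deriv_sums[of lam] assms by (auto simp: sums_iff)
  then show "summable (\<lambda>k. (lam * ?C) * (of_nat (Suc k) * lam ^ k))"
    by (rule summable_mult)
  fix k :: nat
  let ?n = "real (Suc k)"
  have n: "1 \<le> ?n" by simp
  have "\<bar>?n * r\<bar> = ?n * \<bar>r\<bar>" by (simp add: abs_mult)
  moreover have "\<bar>b\<bar> \<le> ?n * \<bar>b\<bar>" using mult_right_mono[OF n, of "\<bar>b\<bar>"] by simp
  moreover have "\<bar>real_of_int \<lfloor>b + ?n * r\<rfloor>\<bar> \<le> \<bar>b + ?n * r\<bar> + 1" by linarith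
  ultimately have "\<bar>real_of_int \<lfloor>b + ?n * r\<rfloor>\<bar> \<le> ?n * \<bar>b\<bar> + ?n * \<bar>r\<bar> + ?n"
    using n by linarith
  also have "\<dots> = ?n * (\<bar>b\<bar> + \<bar>r\<bar> + 1)" by (simp add: algebra_simps)
  finally have "(1 - lam) * \<bar>real_of_int \<lfloor>b + ?n * r\<rfloor>\<bar> \<le> (1 - lam) * (?n * (\<bar>b\<bar> + \<bar>r\<bar> + 1))"
    using assms by (intro mult_left_mono) auto
  moreover have "\<bar>d * theta c (frac (b + ?n * r))\<bar> \<le> ?n * \<bar>d\<bar>"
    using mult_right_mono[OF n, of "\<bar>d\<bar>"] by (auto simp: theta_def)
  moreover have "\<bar>?s k\<bar> \<le> (1 - lam) * \<bar>real_of_int \<lfloor>b + ?n * r\<rfloor>\<bar> + \<bar>d * theta c (frac (b + ?n * r))\<bar>"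
    using assms by (intro order_trans[OF abs_triangle_ineq]) (simp add: abs_mult)
  ultimately have "\<bar>?s k\<bar> \<le> (1 - lam) * (?n * (\<bar>b\<bar> + \<bar>r\<bar> + 1)) + ?n * \<bar>d\<bar>" by linarith
  also have "\<dots> = ?n * ?C" by (simp add: algebra_simps del: of_nat_Suc)
  finally have "lam ^ Suc k * \<bar>?s k\<bar> \<le> lam ^ Suc k * (?n * ?C)"
    using assms by (intro mult_left_mono) auto
  moreover have "norm (lam ^ Suc k * ?s k) = lam ^ Suc k * \<bar>?s k\<bar>"
    using assms by (simp add: abs_mult del: of_nat_Suc)
  moreover have "lam ^ Suc k * (?n * ?C) = (lam * ?C) * (?n * lam ^ k)"
    by (simp only: power_Suc ac_simps)
  ultimately show "norm (lam ^ Suc k * ?s k) \<le> (lam * ?C) * (of_nat (Suc k) * lam ^ k)" by linarith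
qed

lemma delta_fun_mono:
  assumes "0 < lam" "lam < 1" "0 < d" "d < 1 - lam" "r \<le> s"
  shows "delta_fun lam d r alpha \<le> delta_fun lam d s alpha"
  unfolding delta_fun_def
  using assms step_summable[OF assms(1,2), of 0]
  by (intro add_left_mono mult_left_mono suminf_le step_mono) (auto simp del: of_nat_Suc)

lemma a_fun_antimono:
  assumes "0 < lam" "lam < 1" "0 < d" "d < 1 - lam" "r \<le> s"
  shows "a_fun lam d delta s alpha \<le> a_fun lam d delta r alpha"
  unfolding a_fun_def
  using assms step_summable[OF assms(1,2), of alpha "- _"]
  by (intro add_left_mono mult_left_mono suminf_le step_mono) (auto simp del: of_nat_Suc)

lemma delta_fun_tendsto_left:
  assumes "0 < lam" "lam < 1" "0 < d" "d < 1 - lam"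
  shows "((\<lambda>r. delta_fun lam d r alpha) \<longlongrightarrow> delta_left lam d rho alpha) (at_left rho)"
proof -
  have "((\<lambda>r. delta_fun lam d r alpha) \<longlongrightarrow>
          Sup ((\<lambda>r. delta_fun lam d r alpha) ` ({..<rho} \<inter> UNIV))) (at rho within ({..<rho} \<inter> UNIV))"
    using delta_fun_mono[OF assms] by (intro Lim_left_bound[where K = "delta_fun lam d rho alpha"]) auto
  then show ?thesis
    unfolding delta_left_def by (simp add: tendsto_Lim)
qed

lemma a_fun_tendsto_right:
  assumes "0 < lam" "lam < 1" "0 < d" "d < 1 - lam"
  shows "((\<lambda>r. a_fun lam d delta r alpha) \<longlongrightarrow> a_right lam d delta rho alpha) (at_right rho)"
proof -
  have "((\<lambda>r. - a_fun lam d delta r alpha) \<longlongrightarrow>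
          Inf ((\<lambda>r. - a_fun lam d delta r alpha) ` ({rho<..} \<inter> UNIV))) (at rho within ({rho<..} \<inter> UNIV))"
    using a_fun_antimono[OF assms] by (intro Lim_right_bound[where K = "- a_fun lam d delta rho alpha"]) auto
  from tendsto_minus[OF this]
  have "((\<lambda>r. a_fun lam d delta r alpha) \<longlongrightarrow>
          - Inf ((\<lambda>r. - a_fun lam d delta r alpha) ` {rho<..})) (at_right rho)"
    by simp
  then show ?thesis
    unfolding a_right_def by (simp add: tendsto_Lim)
qed

lemma delta_left_le:
  assumes "0 < lam" "lam < 1" "0 < d" "d < 1 - lam"
  shows "delta_left lam d rho alpha \<le> delta_fun lam d rho alpha"
  using delta_fun_mono[OF assms] eventually_at_left_real[of "rho - 1" rho]
  by (intro tendsto_upperbound[OF delta_fun_tendsto_left[OF assms]])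
     (auto elim!: eventually_mono)

lemma a_right_le:
  assumes "0 < lam" "lam < 1" "0 < d" "d < 1 - lam"
  shows "a_right lam d delta rho alpha \<le> a_fun lam d delta rho alpha"
  using a_fun_antimono[OF assms] eventually_at_right_real[of rho "rho + 1"]
  by (intro tendsto_upperbound[OF a_fun_tendsto_right[OF assms]])
     (auto elim!: eventually_mono)

end

theory Submission
  imports Defs
begin

text \<open>
  Since \<open>theta c (frac x) = \<lfloor>x + 1 - c\<rfloor> - \<lfloor>x\<rfloor>\<close> for \<open>c\<close> in \<open>[0, 1]\<close>, all quantities are combinations of
  \<open>F x = \<Sum>k\<ge>1. lam ^ k * \<lfloor>k * rho + x\<rfloor>\<close> and its left limit in \<open>rho\<close>, written \<open>F' x\<close>, at the three points
  \<open>x = 0\<close>, \<open>x = alpha\<close> and \<open>x = - alpha\<close>. With \<open>L = lam / (1 - lam)\<close> one has \<open>F (x + 1) = F x + L\<close> and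
  \<open>F x / lam = \<lfloor>rho + x\<rfloor> + F (rho + x)\<close>, likewise for \<open>F'\<close>, and \<open>F y \<le> F' x\<close> whenever \<open>y < x\<close>, strictly
  if \<open>rho\<close> is irrational, by Kronecker's theorem. Up to the factor \<open>lam\<close>, the gaps between the end points of
  the interval for \<open>a\<close> and the numbers \<open>0\<close>, \<open>1\<close>, \<open>eta1\<close>, \<open>eta2\<close> are nonnegative combinations of such
  differences \<open>F' x - F y\<close> and of the distance from \<open>delta\<close> to an end point of its own interval.
\<close>

section \<open>The floor series, its left limit in the slope, and their convergence\<close>

definition floor_series :: "real \<Rightarrow> real \<Rightarrow> real \<Rightarrow> real" where
  "floor_series lam s x = (\<Sum>k. lam ^ Suc k * of_int \<lfloor>real (Suc k) * s + x\<rfloor>)"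

text \<open>\<open>\<lceil>y\<rceil> - 1\<close> is the left limit of the floor function at \<open>y\<close>.\<close>
definition floor_series_left :: "real \<Rightarrow> real \<Rightarrow> real \<Rightarrow> real" where
  "floor_series_left lam s x = (\<Sum>k. lam ^ Suc k * of_int (\<lceil>real (Suc k) * s + x\<rceil> - 1))"

lemma summable_Suc_power:
  fixes lam :: real
  assumes "0 < lam" "lam < 1"
  shows "summable (\<lambda>k. lam ^ Suc k * (real (Suc k) * c))"
proof -
  have "summable (\<lambda>k. of_nat (Suc k) * lam ^ k)"
    using geometric_deriv_sums[of lam] assms by (auto simp: sums_iff)
  from summable_mult[OF this, of "lam * c"] show ?thesis
    by (simp add: mult_ac)
qed

text \<open>The constant involves only the absolute values of \<open>s\<close> and \<open>x\<close>,
  so the bound serves summability and also, with the slope varying near a point, domination in the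
  limit.\<close>

lemma near_affine_bound:
  fixes s x t :: real
  assumes "real (Suc k) * s + x - 1 \<le> t" "t \<le> real (Suc k) * s + x"
  shows "\<bar>t\<bar> \<le> real (Suc k) * (\<bar>s\<bar> + \<bar>x\<bar> + 1)"
proof -
  have "\<bar>x\<bar> \<le> real (Suc k) * \<bar>x\<bar>"
    using mult_right_mono[of 1 "real (Suc k)" "\<bar>x\<bar>"] by simp
  moreover have "\<bar>real (Suc k) * s\<bar> = real (Suc k) * \<bar>s\<bar>"
    by (simp add: abs_mult)
  moreover have "1 \<le> real (Suc k)" by simp
  ultimately have "\<bar>t\<bar> \<le> real (Suc k) * \<bar>s\<bar> + real (Suc k) * \<bar>x\<bar> + real (Suc k)"
    using assms by linarith
  then show ?thesis by (simp only: distrib_left mult_1_right)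
qed

text \<open>The closed window of length one contains both the floor and the ceiling minus one, so
  both series are covered.\<close>

lemma summable_near_affine:
  fixes lam s x :: real
  assumes "0 < lam" "lam < 1"
    and "\<And>k. real (Suc k) * s + x - 1 \<le> t k" "\<And>k. t k \<le> real (Suc k) * s + x"
  shows "summable (\<lambda>k. lam ^ Suc k * t k)"
proof (rule summable_comparison_test'[OF summable_Suc_power[OF assms(1,2)]])
  fix k
  show "norm (lam ^ Suc k * t k) \<le> lam ^ Suc k * (real (Suc k) * (\<bar>s\<bar> + \<bar>x\<bar> + 1))"
    using near_affine_bound[OF assms(3,4), of k] assms(1)
    by (simp add: abs_mult mult_left_mono del: of_nat_Suc power_Suc)
qed

context
  fixes lam :: real
  assumes lam: "0 < lam" "lam < 1"
begin

lemma summable_floor_series: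
  "summable (\<lambda>k. lam ^ Suc k * of_int \<lfloor>real (Suc k) * s + x\<rfloor>)"
  by (rule summable_near_affine[OF lam, of s x]; linarith)

lemma summable_floor_series_left:
  "summable (\<lambda>k. lam ^ Suc k * of_int (\<lceil>real (Suc k) * s + x\<rceil> - 1))"
  by (rule summable_near_affine[OF lam, of s x]; linarith)

lemma geometric_Suc_sums: "(\<lambda>k. lam ^ Suc k) sums (lam / (1 - lam))"
  using sums_mult[OF geometric_sums[of lam], of lam] lam by simp

lemma summable_of_nat_series: "summable (\<lambda>k. lam ^ Suc k * real k)"
proof -
  have "summable (\<lambda>k. lam ^ Suc k * (real (Suc k) * 1) - lam ^ Suc k)"
    by (intro summable_diff summable_Suc_power[OF lam] sums_summable[OF geometric_Suc_sums])
  then show ?thesis by (simp add: algebra_simps)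
qed

text \<open>Reindexing by one gives \<open>S = lam * (S + lam / (1 - lam))\<close>. The sum is the
  value of \<open>floor_series_left\<close> at slope 1 and offset 0, the bound for slopes below
  1.\<close>

lemma suminf_of_nat_series: "(\<Sum>k. lam ^ Suc k * real k) = (lam / (1 - lam))\<^sup>2"
proof -
  let ?S = "\<Sum>k. lam ^ Suc k * real k"
  have "?S = (\<Sum>k. lam ^ Suc (Suc k) * real (Suc k))"
    using suminf_split_head[OF summable_of_nat_series] by simp
  also have "\<dots> = (\<Sum>k. lam * (lam ^ Suc k * real k + lam ^ Suc k))"
    by (simp add: algebra_simps)
  also have "\<dots> = lam * (?S + lam / (1 - lam))"
    using summable_of_nat_series geometric_Suc_sums
    by (simp only: suminf_mult suminf_add[symmetric] summable_add sums_iff)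
  finally show ?thesis using lam by (simp add: divide_simps power2_eq_square) argo
qed

lemma suminf_weighted_less:
  fixes f g :: "nat \<Rightarrow> real"
  assumes "summable (\<lambda>k. lam ^ Suc k * f k)" "summable (\<lambda>k. lam ^ Suc k * g k)"
    and "\<And>k. f k \<le> g k" "f j < g j"
  shows "(\<Sum>k. lam ^ Suc k * f k) < (\<Sum>k. lam ^ Suc k * g k)"
proof -
  have "0 < (\<Sum>k. lam ^ Suc k * g k - lam ^ Suc k * f k)"
  proof (rule suminf_pos2[where i = j])
    show "summable (\<lambda>k. lam ^ Suc k * g k - lam ^ Suc k * f k)"
      using assms by (intro summable_diff)
    show "0 \<le> lam ^ Suc k * g k - lam ^ Suc k * f k" for k
      using lam assms(3)[of k] by (simp add: mult_left_mono)
    show "0 < lam ^ Suc j * g j - lam ^ Suc j * f j"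
      using lam assms(4) by simp
  qed
  then show ?thesis using suminf_diff[OF assms(2,1)] by simp
qed

section \<open>Monotonicity in the offset\<close>

lemma floor_series_mono: "x \<le> y \<Longrightarrow> floor_series lam s x \<le> floor_series lam s y"
  unfolding floor_series_def using lam
  by (intro suminf_le summable_floor_series mult_left_mono) (auto intro!: floor_mono)

lemma floor_series_left_mono: "x \<le> y \<Longrightarrow> floor_series_left lam s x \<le> floor_series_left lam s y"
  unfolding floor_series_left_def using lam
  by (intro suminf_le summable_floor_series_left mult_left_mono) (auto intro!: ceiling_mono)

lemma floor_series_left_le: "floor_series_left lam s x \<le> floor_series lam s x"
  unfolding floor_series_def floor_series_left_def using lam
  by (intro suminf_le summable_floor_series_left summable_floor_series mult_left_mono)
     (auto simp del: of_nat_Suc of_int_diff, linarith)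

lemma floor_less_ceiling: "y < x \<Longrightarrow> \<lfloor>y\<rfloor> < \<lceil>x\<rceil>" for x y :: real
  by linarith

lemma floor_series_le_left: "y < x \<Longrightarrow> floor_series lam s y \<le> floor_series_left lam s x"
  unfolding floor_series_def floor_series_left_def using lam
  by (intro suminf_le summable_floor_series_left summable_floor_series mult_left_mono)
     (auto simp del: of_nat_Suc of_int_diff intro!: floor_less_ceiling)

text \<open>By Kronecker's theorem some \<open>k * s\<close> lies in the open interval \<open>(n - x, n - y)\<close> for an integer \<open>n\<close>.\<close>
lemma floor_series_less_left:
  assumes "s \<notin> \<rat>" "y < x"
  shows "floor_series lam s y < floor_series_left lam s x"
proof -
  obtain h k :: int where k: "k > 0" and
    hk: "\<bar>of_int k * s - of_int h - (- (x + y) / 2)\<bar> < (x - y) / 2"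
    using sequence_of_fractional_parts_is_dense[of s "(x - y) / 2" "- (x + y) / 2"] assms
    by (metis diff_gt_0_iff_gt half_gt_zero)
  obtain j where j: "k = int (Suc j)" using k by (metis zero_less_imp_eq_int gr0_implies_Suc)
  have "real (Suc j) * s + y < h" "h < real (Suc j) * s + x"
    using hk unfolding j of_int_of_nat_eq abs_less_iff by argo+
  \<comment> \<open>The integer \<open>h\<close> lies strictly between the two points: the floor of
    the lower one is below \<open>h\<close>, the ceiling of the upper one above it.\<close>
  then have "real_of_int \<lfloor>real (Suc j) * s + y\<rfloor> < of_int (\<lceil>real (Suc j) * s + x\<rceil> - 1)"
    unfolding of_int_less_iff floor_less_iff[symmetric] less_ceiling_iff[symmetric] by linarith
  then show ?thesis
    unfolding floor_series_def floor_series_left_def using assms(2)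
    by (intro suminf_weighted_less[where j = j] summable_floor_series summable_floor_series_left)
       (auto simp del: of_nat_Suc of_int_diff intro!: floor_less_ceiling)
qed

section \<open>Functional equations in the offset and the slope\<close>

lemma floor_series_add_one: "floor_series lam s (x + 1) = floor_series lam s x + lam / (1 - lam)"
proof -
  have "floor_series lam s (x + 1) = (\<Sum>k. lam ^ Suc k * of_int \<lfloor>real (Suc k) * s + x\<rfloor> + lam ^ Suc k)"
  proof -
    have "\<lfloor>real (Suc k) * s + (x + 1)\<rfloor> = \<lfloor>real (Suc k) * s + x\<rfloor> + 1" for k by linarith
    then show ?thesis
      unfolding floor_series_def by (simp only: of_int_add of_int_1 distrib_left mult_1_right)
  qed
  then show ?thesis
    unfolding floor_series_def
    using suminf_add[OF summable_floor_series[of s x] sums_summable[OF geometric_Suc_sums]]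
      sums_unique[OF geometric_Suc_sums] by (simp only:)
qed

lemma floor_series_left_add_one:
  "floor_series_left lam s (x + 1) = floor_series_left lam s x + lam / (1 - lam)"
proof -
  have "floor_series_left lam s (x + 1) =
          (\<Sum>k. lam ^ Suc k * of_int (\<lceil>real (Suc k) * s + x\<rceil> - 1) + lam ^ Suc k)"
  proof -
    have "\<lceil>real (Suc k) * s + (x + 1)\<rceil> - 1 = (\<lceil>real (Suc k) * s + x\<rceil> - 1) + 1" for k by linarith
    then show ?thesis
      unfolding floor_series_left_def
      by (simp only: of_int_add[of _ 1] of_int_1 distrib_left mult_1_right)
  qed
  then show ?thesis
    unfolding floor_series_left_def
    using suminf_add[OF summable_floor_series_left[of s x] sums_summable[OF geometric_Suc_sums]]
      sums_unique[OF geometric_Suc_sums] by (simp only:)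
qed

text \<open>The first term splits off; in the remaining ones a copy of the slope moves into the
  offset and one factor \<open>lam\<close> comes out.\<close>

lemma floor_series_shift:
  "floor_series lam s x = lam * (of_int \<lfloor>s + x\<rfloor> + floor_series lam s (s + x))"
proof -
  have "floor_series lam s x = lam * of_int \<lfloor>s + x\<rfloor>
          + (\<Sum>k. lam ^ Suc (Suc k) * of_int \<lfloor>real (Suc (Suc k)) * s + x\<rfloor>)"
    unfolding floor_series_def using suminf_split_head[OF summable_floor_series[of s x]] by simp
  also have "(\<Sum>k. lam ^ Suc (Suc k) * of_int \<lfloor>real (Suc (Suc k)) * s + x\<rfloor>) =
      (\<Sum>k. lam * (lam ^ Suc k * of_int \<lfloor>real (Suc k) * s + (s + x)\<rfloor>))"
  proof -
    have "real (Suc (Suc k)) * s + x = real (Suc k) * s + (s + x)" for k by (simp add: distrib_right)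
    then show ?thesis by (simp only: power_Suc[of lam "Suc _"] mult.assoc)
  qed
  also have "\<dots> = lam * floor_series lam s (s + x)"
    unfolding floor_series_def by (rule suminf_mult[OF summable_floor_series])
  finally show ?thesis by (simp add: distrib_left)
qed

lemma floor_series_left_shift:
  "floor_series_left lam s x = lam * (of_int (\<lceil>s + x\<rceil> - 1) + floor_series_left lam s (s + x))"
proof -
  have "floor_series_left lam s x = lam * of_int (\<lceil>s + x\<rceil> - 1)
          + (\<Sum>k. lam ^ Suc (Suc k) * of_int (\<lceil>real (Suc (Suc k)) * s + x\<rceil> - 1))"
    unfolding floor_series_left_def
    using suminf_split_head[OF summable_floor_series_left[of s x]] by simp
  also have "(\<Sum>k. lam ^ Suc (Suc k) * of_int (\<lceil>real (Suc (Suc k)) * s + x\<rceil> - 1)) =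
      (\<Sum>k. lam * (lam ^ Suc k * of_int (\<lceil>real (Suc k) * s + (s + x)\<rceil> - 1)))"
  proof -
    have "real (Suc (Suc k)) * s + x = real (Suc k) * s + (s + x)" for k by (simp add: distrib_right)
    then show ?thesis by (simp only: power_Suc[of lam "Suc _"] mult.assoc)
  qed
  also have "\<dots> = lam * floor_series_left lam s (s + x)"
    unfolding floor_series_left_def by (rule suminf_mult[OF summable_floor_series_left])
  finally show ?thesis by (simp add: distrib_left)
qed

text \<open>\<open>a_fun\<close> is built from series of slope \<open>- rho\<close>; reflection
  brings them back to slope \<open>rho\<close> and exchanges the series with its left limit.
  Termwise \<lfloor>- y\<rfloor> = - (\<lceil>y\<rceil> - 1) - 1, and the trailing ones sum to
  \<open>lam / (1 - lam)\<close>.\<close>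

lemma floor_series_minus:
  "floor_series lam (- s) x = - floor_series_left lam s (- x) - lam / (1 - lam)"
proof -
  have "lam ^ Suc k * of_int \<lfloor>real (Suc k) * (- s) + x\<rfloor> =
      - (lam ^ Suc k * of_int (\<lceil>real (Suc k) * s + - x\<rceil> - 1)) - lam ^ Suc k" for k
    using ceiling_minus[of "real (Suc k) * s + - x"]
    by (simp add: ceiling_def algebra_simps del: of_nat_Suc power_Suc)
  then show ?thesis
    unfolding floor_series_def floor_series_left_def
    using summable_floor_series_left[of s "- x"] geometric_Suc_sums
    by (simp only: suminf_minus[symmetric] suminf_diff[symmetric] summable_minus sums_iff)
qed

lemma floor_series_left_minus:
  "floor_series_left lam (- s) x = - floor_series lam s (- x) - lam / (1 - lam)"
  using floor_series_minus[of "- s" "- x"] by simp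

section \<open>Jumps in the slope and strict bounds at offset 0\<close>

lemma floor_series_left_eq:
  assumes "\<And>k. real (Suc k) * s + x \<notin> \<int>"
  shows "floor_series_left lam s x = floor_series lam s x"
proof -
  have "\<lceil>real (Suc k) * s + x\<rceil> - 1 = \<lfloor>real (Suc k) * s + x\<rfloor>" for k
    using assms[of k] by (simp add: ceiling_altdef Ints_def) (metis rangeI)
  then show ?thesis unfolding floor_series_def floor_series_left_def by simp
qed

text \<open>The term whose index is a denominator of \<open>s\<close> has an integer argument, where
  the floor exceeds its left limit by one.\<close>

lemma floor_series_zero_jump:
  assumes "s \<in> \<rat>"
  shows "floor_series_left lam s 0 < floor_series lam s 0"
proof -
  obtain a b :: int where ab: "b > 0" "s = of_int a / of_int b"
    using assms by (metis Rats_cases')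
  obtain j where j: "b = int (Suc j)" using ab(1) by (metis zero_less_imp_eq_int gr0_implies_Suc)
  have "real (Suc j) * s = of_int a"
    using ab(2) unfolding j by simp
  then have "real_of_int (\<lceil>real (Suc j) * s + 0\<rceil> - 1) < of_int \<lfloor>real (Suc j) * s + 0\<rfloor>"
    by simp
  moreover have "real_of_int (\<lceil>y\<rceil> - 1) \<le> of_int \<lfloor>y\<rfloor>" for y :: real
    unfolding of_int_le_iff by linarith
  ultimately show ?thesis
    unfolding floor_series_def floor_series_left_def
    by (intro suminf_weighted_less[where j = j] summable_floor_series summable_floor_series_left)
qed

text \<open>No term is negative, and a term with \<open>Suc k * s > 1\<close> is positive.\<close>

lemma floor_series_left_zero_pos:
  assumes "0 < s"
  shows "0 < floor_series_left lam s 0"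
proof -
  obtain j where j: "1 < real (Suc j) * s"
    using reals_Archimedean3[OF assms] by (metis mult_zero_left not_one_less_zero of_nat_0 not0_implies_Suc)
  have "0 < real (Suc k) * s" for k using assms by simp
  then have nn: "0 \<le> \<lceil>real (Suc k) * s\<rceil> - 1" for k by (simp add: less_ceiling_iff zle_diff1_eq del: of_nat_Suc)
  have "0 < real_of_int (\<lceil>real (Suc j) * s\<rceil> - 1)" using j by linarith
  then have "(\<Sum>k. lam ^ Suc k * 0) < floor_series_left lam s 0"
    unfolding floor_series_left_def using nn
    by (intro suminf_weighted_less[where j = j] summable_floor_series_left)
       (simp_all del: of_nat_Suc of_int_diff)
  then show ?thesis by simp
qed

text \<open>For \<open>s < 1\<close> the floor at index \<open>Suc k\<close> is at most
  \<open>k\<close>, and strictly less once \<open>Suc k * (1 - s) > 1\<close>.\<close>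

lemma floor_series_zero_less:
  assumes "s < 1"
  shows "floor_series lam s 0 < (lam / (1 - lam))\<^sup>2"
proof -
  obtain j where j: "1 < real (Suc j) * (1 - s)"
    using reals_Archimedean3[of "1 - s"] assms
    by (metis diff_gt_0_iff_gt mult_zero_left not_one_less_zero of_nat_0 not0_implies_Suc)
  have le: "real_of_int \<lfloor>real (Suc k) * s\<rfloor> \<le> real k" for k
  proof -
    have "real (Suc k) * s < of_int (int k + 1)"
      using mult_strict_left_mono[OF assms, of "real (Suc k)"] by (simp add: add.commute)
    then have "\<lfloor>real (Suc k) * s\<rfloor> \<le> int k" unfolding floor_less_iff[symmetric] by linarith
    then show ?thesis by linarith
  qed
  have "real (Suc j) * s < real j" using j by (simp add: right_diff_distrib)
  then have "real_of_int \<lfloor>real (Suc j) * s\<rfloor> < real j" by linarith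
  then show ?thesis
    unfolding floor_series_def suminf_of_nat_series[symmetric] using le
    by (intro suminf_weighted_less[where j = j] summable_floor_series summable_of_nat_series)
       (simp_all del: of_nat_Suc)
qed

section \<open>The limit as the slope increases\<close>

lemma tendsto_floor_series_left:
  "((\<lambda>r. floor_series lam r x) \<longlongrightarrow> floor_series_left lam s x) (at_left s)"
proof -
  have near: "eventually (\<lambda>r. s - 1 < r \<and> r < s) (at_left s)"
    using eventually_at_left_real[of "s - 1" s] by (auto elim: eventually_mono)
  \<comment> \<open>By Tannery's theorem it suffices that each term is eventually constant as the
    slope increases to \<open>s\<close> and that the terms are dominated near
    \<open>s\<close>.\<close>
  have "((\<lambda>r. \<Sum>k. lam ^ Suc k * of_int \<lfloor>real (Suc k) * r + x\<rfloor>) \<longlongrightarrow>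
      (\<Sum>k. lam ^ Suc k * of_int (\<lceil>real (Suc k) * s + x\<rceil> - 1))) (at_left s)"
  proof (rule tannerys_theorem[THEN conjunct2, THEN conjunct2])
    fix k
    let ?n = "real (Suc k)"
    \<comment> \<open>The slope at which the argument of the floor equals the largest integer
      strictly below its value at \<open>s\<close>; between \<open>?c\<close> and \<open>s\<close>
      the floor does not change.\<close>
    let ?c = "(of_int (\<lceil>?n * s + x\<rceil> - 1) - x) / ?n"
    have n: "?n > 0" by simp
    have "of_int (\<lceil>?n * s + x\<rceil> - 1) - x < s * ?n" by (simp only: mult.commute[of s]) linarith
    then have c: "?c < s" using n by (simp add: pos_divide_less_eq del: of_nat_Suc)
    have "eventually (\<lambda>r. \<lfloor>?n * r + x\<rfloor> = \<lceil>?n * s + x\<rceil> - 1) (at_left s)"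
      using eventually_at_left_real[OF c]
    proof (rule eventually_mono)
      fix r assume r: "r \<in> {?c<..<s}"
      have "?c < r" "r < s" using r by auto
      then have "of_int (\<lceil>?n * s + x\<rceil> - 1) - x < ?n * r" "?n * r < ?n * s"
        using n by (simp_all add: pos_divide_less_eq mult.commute del: of_nat_Suc)
      then show "\<lfloor>?n * r + x\<rfloor> = \<lceil>?n * s + x\<rceil> - 1" by linarith
    qed
    then show "((\<lambda>r. lam ^ Suc k * of_int \<lfloor>?n * r + x\<rfloor>) \<longlongrightarrow>
        lam ^ Suc k * of_int (\<lceil>?n * s + x\<rceil> - 1)) (at_left s)"
      by (intro tendsto_eventually) (erule eventually_mono, simp only:)
  next
    \<comment> \<open>Within distance 1 of \<open>s\<close> one has
      \<open>\<bar>r\<bar> \<le> \<bar>s\<bar> + 1\<close>, which makes the bound independent of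
      \<open>r\<close>.\<close>
    have "eventually (\<lambda>(k, r). True \<and> (s - 1 < r \<and> r < s)) (at_top \<times>\<^sub>F at_left s)"
      using eventually_prodI[OF eventually_True near, of at_top] by (simp add: case_prod_unfold)
    then show "eventually (\<lambda>(k, r). norm (lam ^ Suc k * of_int \<lfloor>real (Suc k) * r + x\<rfloor>)
        \<le> lam ^ Suc k * (real (Suc k) * (\<bar>s\<bar> + 1 + \<bar>x\<bar> + 1))) (at_top \<times>\<^sub>F at_left s)"
    proof (rule eventually_mono, clarify)
      fix k r assume r: "s - 1 < r" "r < s"
      have "\<bar>real_of_int \<lfloor>real (Suc k) * r + x\<rfloor>\<bar> \<le> real (Suc k) * (\<bar>r\<bar> + \<bar>x\<bar> + 1)"
        by (rule near_affine_bound) linarith+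
      also have "\<dots> \<le> real (Suc k) * (\<bar>s\<bar> + 1 + \<bar>x\<bar> + 1)"
        using r by (intro mult_left_mono) auto
      finally show "norm (lam ^ Suc k * of_int \<lfloor>real (Suc k) * r + x\<rfloor>)
          \<le> lam ^ Suc k * (real (Suc k) * (\<bar>s\<bar> + 1 + \<bar>x\<bar> + 1))"
        using lam by (simp add: abs_mult mult_left_mono del: of_nat_Suc power_Suc)
    qed
  qed (use summable_Suc_power[OF lam] in auto)
  then show ?thesis unfolding floor_series_def floor_series_left_def .
qed

end

section \<open>The functions for \<open>delta\<close> and \<open>a\<close> in terms of floor
  series\<close>

lemma theta_frac:
  assumes "0 \<le> c" "c \<le> 1"
  shows "theta c (frac x) = of_int \<lfloor>x + 1 - c\<rfloor> - of_int \<lfloor>x\<rfloor>"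
proof (cases "frac x < c")
  case True
  then have "\<lfloor>x + 1 - c\<rfloor> = \<lfloor>x\<rfloor>" using assms unfolding frac_def by linarith
  then show ?thesis using True by (simp add: theta_def)
next
  case False
  then have "\<lfloor>x + 1 - c\<rfloor> = \<lfloor>x\<rfloor> + 1" using assms frac_lt_1[of x] unfolding frac_def by linarith
  then show ?thesis using False by (simp add: theta_def)
qed

text \<open>For \<open>c = 1 - alpha\<close> the step \<open>theta\<close> is a difference of floors
  at offsets \<open>alpha\<close> and 0; the subtracted part lowers the weight
  \<open>1 - lam\<close> to \<open>1 - lam - d\<close>.\<close>

lemma delta_fun_floor_series:
  assumes "0 < lam" "lam < 1" "0 \<le> alpha" "alpha \<le> 1"
  shows "delta_fun lam d r alpha = 1 - lam - d + (1 - lam) / lam *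
           ((1 - lam - d) * floor_series lam r 0 + d * floor_series lam r alpha)"
proof -
  note summ = summable_floor_series[OF assms(1,2), of r]
  have "(\<Sum>k. lam ^ Suc k * ((1 - lam) * of_int \<lfloor>real (Suc k) * r\<rfloor>
             + d * theta (1 - alpha) (frac (real (Suc k) * r)))) =
        (\<Sum>k. (1 - lam - d) * (lam ^ Suc k * of_int \<lfloor>real (Suc k) * r + 0\<rfloor>)
             + d * (lam ^ Suc k * of_int \<lfloor>real (Suc k) * r + alpha\<rfloor>))"
    using assms by (intro suminf_cong) (simp add: theta_frac algebra_simps del: of_nat_Suc power_Suc)
  also have "\<dots> = (1 - lam - d) * floor_series lam r 0 + d * floor_series lam r alpha"
    unfolding floor_series_def
    by (simp only: suminf_add[symmetric] suminf_mult summable_mult summ)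
  finally show ?thesis unfolding delta_fun_def by simp
qed

text \<open>For \<open>c = alpha\<close> the raised offset is \<open>alpha + 1 - alpha = 1\<close>,
  whatever \<open>alpha\<close> is.\<close>

lemma a_fun_floor_series:
  assumes "0 < lam" "lam < 1" "0 \<le> alpha" "alpha \<le> 1"
  shows "a_fun lam d delta r alpha = delta / (1 - lam) + 1 / lam *
           ((1 - lam - d) * floor_series lam (- r) alpha + d * floor_series lam (- r) 1)"
proof -
  note summ = summable_floor_series[OF assms(1,2), of "- r"]
  have "(\<Sum>k. lam ^ Suc k * ((1 - lam) * of_int \<lfloor>alpha - real (Suc k) * r\<rfloor>
             + d * theta alpha (frac (alpha - real (Suc k) * r)))) =
        (\<Sum>k. (1 - lam - d) * (lam ^ Suc k * of_int \<lfloor>real (Suc k) * (- r) + alpha\<rfloor>)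
             + d * (lam ^ Suc k * of_int \<lfloor>real (Suc k) * (- r) + 1\<rfloor>))"
    using assms by (intro suminf_cong) (simp add: theta_frac algebra_simps del: of_nat_Suc power_Suc)
  also have "\<dots> = (1 - lam - d) * floor_series lam (- r) alpha + d * floor_series lam (- r) 1"
    unfolding floor_series_def
    by (simp only: suminf_add[symmetric] suminf_mult summable_mult summ)
  finally show ?thesis unfolding a_fun_def by simp
qed

lemma delta_left_floor_series:
  assumes "0 < lam" "lam < 1" "0 \<le> alpha" "alpha \<le> 1"
  shows "delta_left lam d rho alpha = 1 - lam - d + (1 - lam) / lam *
           ((1 - lam - d) * floor_series_left lam rho 0 + d * floor_series_left lam rho alpha)"
  unfolding delta_left_def delta_fun_floor_series[OF assms]
  by (intro tendsto_Lim tendsto_intros tendsto_floor_series_left[OF assms(1,2)]) simp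

text \<open>A right limit at \<open>rho\<close> is a left limit at \<open>- rho\<close> in the
  negated slope.\<close>

lemma a_right_floor_series:
  assumes "0 < lam" "lam < 1" "0 \<le> alpha" "alpha \<le> 1"
  shows "a_right lam d delta rho alpha = delta / (1 - lam) + 1 / lam *
           ((1 - lam - d) * floor_series_left lam (- rho) alpha + d * floor_series_left lam (- rho) 1)"
proof -
  have "((\<lambda>r. floor_series lam (- r) x) \<longlongrightarrow> floor_series_left lam (- rho) x) (at_right rho)" for x
    unfolding at_right_minus[of rho] filterlim_filtermap
    using tendsto_floor_series_left[OF assms(1,2)] by simp
  then show ?thesis
    unfolding a_right_def a_fun_floor_series[OF assms]
    by (intro tendsto_Lim tendsto_intros) auto
qed

section \<open>Bounds for \<open>delta\<close> and \<open>a\<close>, and the location of the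
  couple\<close>

theorem proposition2p4:
  fixes lam d rho alpha delta :: real
  assumes lam: "lam \<in> {0<..<1}"
    and d: "d \<in> {0<..<1 - lam}"
    and rho: "rho \<in> {0<..<1}"
    and alpha: "alpha \<in> {0..1}"
    and delta: "delta \<in> {delta_left lam d rho alpha .. delta_fun lam d rho alpha}"
  shows
    "(rho \<notin> \<rat> \<longrightarrow>
        (\<forall>a \<in> {a_right lam d delta rho alpha .. a_fun lam d delta rho alpha}.
           (alpha \<in> {0..<1 - rho} \<longrightarrow> (delta, a) \<in> M1 lam d) \<and>
           (alpha = 1 - rho \<longrightarrow> (delta, a) \<in> M2 lam d) \<and>
           (alpha \<in> {1 - rho<..1} \<longrightarrow> (delta, a) \<in> M3 lam)))
     \<and>
     (rho \<in> \<rat> \<longrightarrow>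
        (\<exists>a \<in> {a_right lam d delta rho alpha .. a_fun lam d delta rho alpha}.
           (alpha \<in> {0..<1 - rho} \<longrightarrow> (delta, a) \<in> M1 lam d) \<and>
           (alpha = 1 - rho \<longrightarrow> (delta, a) \<in> M2 lam d) \<and>
           (alpha \<in> {1 - rho<..1} \<longrightarrow> (delta, a) \<in> M3 lam)))
     \<and>
     (alpha \<in> {0..<1 - rho} \<longrightarrow>
        delta \<in> {1 - lam - d<..<1 - d}
        \<and>
        (alpha \<noteq> 0 \<longrightarrow>
           {a_right lam d delta rho alpha .. a_fun lam d delta rho alpha} \<subseteq> {0..eta1 lam d delta} \<and>
           (a_right lam d delta rho alpha = 0 \<longrightarrow>
              rho \<in> \<rat> \<and> delta = delta_left lam d rho alpha) \<and>
           (a_fun lam d delta rho alpha = eta1 lam d delta \<longrightarrow>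
              rho \<in> \<rat> \<and> delta = delta_fun lam d rho alpha))
        \<and>
        (alpha = 0 \<longrightarrow>
           (rho \<notin> \<rat> \<longrightarrow>
              a_right lam d delta rho alpha = a_fun lam d delta rho alpha \<and>
              a_fun lam d delta rho alpha = 0) \<and>
           (rho \<in> \<rat> \<longrightarrow>
              a_right lam d delta rho alpha \<le> 0 \<and>
              0 \<le> a_fun lam d delta rho alpha \<and>
              a_fun lam d delta rho alpha \<le> eta1 lam d delta \<and>
              (delta \<noteq> delta_fun lam d rho alpha \<longrightarrow>
                 a_fun lam d delta rho alpha < eta1 lam d delta))))
     \<and>
     (alpha \<in> {1 - rho<..1} \<longrightarrow>
        delta \<in> {1 - lam<..<1}
        \<and>
        (alpha \<noteq> 1 \<longrightarrow>
           {a_right lam d delta rho alpha .. a_fun lam d delta rho alpha} \<subseteq> {eta2 lam delta..1} \<and>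
           (a_right lam d delta rho alpha = eta2 lam delta \<longrightarrow>
              rho \<in> \<rat> \<and> delta = delta_left lam d rho alpha) \<and>
           (a_fun lam d delta rho alpha = 1 \<longrightarrow>
              rho \<in> \<rat> \<and> delta = delta_fun lam d rho alpha))
        \<and>
        (alpha = 1 \<longrightarrow>
           (rho \<notin> \<rat> \<longrightarrow>
              a_right lam d delta rho alpha = a_fun lam d delta rho alpha \<and>
              a_fun lam d delta rho alpha = 1) \<and>
           (rho \<in> \<rat> \<longrightarrow>
              eta2 lam delta \<le> a_right lam d delta rho alpha \<and>
              a_right lam d delta rho alpha \<le> 1 \<and>
              1 \<le> a_fun lam d delta rho alpha \<and>
              (delta \<noteq> delta_left lam d rho alpha \<longrightarrow>
                 eta2 lam delta < a_right lam d delta rho alpha) \<and>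
              (delta \<noteq> delta_fun lam d rho alpha \<longrightarrow>
                 a_right lam d delta rho alpha < 1))))
     \<and>
     (alpha = 1 - rho \<longrightarrow>
        delta \<in> {1 - lam - d<..<1}
        \<and>
        (rho \<notin> \<rat> \<longrightarrow>
           a_right lam d delta rho alpha = a_fun lam d delta rho alpha \<and>
           a_fun lam d delta rho alpha \<in> {eta1 lam d delta..eta2 lam delta})
        \<and>
        (rho \<in> \<rat> \<longrightarrow>
           {a_right lam d delta rho alpha .. a_fun lam d delta rho alpha}
             \<inter> {eta1 lam d delta..eta2 lam delta} \<noteq> {})
        \<and>
        (a_fun lam d delta rho alpha = eta1 lam d delta
           \<longleftrightarrow> delta = delta_left lam d rho alpha)
        \<and>
        (a_right lam d delta rho alpha = eta2 lam delta
           \<longleftrightarrow> delta = delta_fun lam d rho alpha))"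
proof -
  define L where "L = lam / (1 - lam)"
  define m where "m = 1 - lam - d"
  define A A' where "A = floor_series lam rho 0" and "A' = floor_series_left lam rho 0"
  define B B' where "B = floor_series lam rho alpha" and "B' = floor_series_left lam rho alpha"
  define C C' where "C = floor_series lam rho (- alpha)" and "C' = floor_series_left lam rho (- alpha)"
  define p q where "p = delta_fun lam d rho alpha" and "q = delta_left lam d rho alpha"
  define a b where "a = a_fun lam d delta rho alpha" and "b = a_right lam d delta rho alpha"
  define e1 e2 where "e1 = eta1 lam d delta" and "e2 = eta2 lam delta"
  have l: "0 < lam" "lam < 1" and dd: "0 < d" "d < 1 - lam" and r: "0 < rho" "rho < 1"
    and al: "0 \<le> alpha" "alpha \<le> 1" and de: "q \<le> delta" "delta \<le> p"
    using assms by (auto simp: p_def q_def)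
  have m: "0 < m" using dd by (simp add: m_def)
  have L: "0 < L" "lam * (1 + L) = L" "(m + d) * L = lam"
    using l by (simp_all add: L_def m_def field_simps)
  note abc = A_def A'_def B_def B'_def C_def C'_def
  note mono = floor_series_mono[OF l, of _ _ rho] floor_series_left_mono[OF l, of _ _ rho]
    floor_series_left_le[OF l, of rho] floor_series_le_left[OF l, of _ _ rho]
    and strict = floor_series_less_left[OF l, of rho]
    and one = floor_series_add_one[OF l, of rho, folded L_def]
    floor_series_left_add_one[OF l, of rho, folded L_def]

  \<comment> \<open>The factor \<open>L\<close> clears \<open>(1 - lam) / lam\<close>, so that the
    relations stay linear in the series values.\<close>
  have p: "L * (p - m) = m * A + d * B"
    using l by (simp add: p_def delta_fun_floor_series[OF l al] abc m_def L_def field_simps)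
  have q: "L * (q - m) = m * A' + d * B'"
    using l by (simp add: q_def delta_left_floor_series[OF l al] abc m_def L_def field_simps)
  have "lam * (delta / (1 - lam)) = L * delta" by (simp add: L_def)
  then have expand: "lam * (delta / (1 - lam) + 1 / lam * x) = L * delta + x" for x
    using l by (simp add: distrib_left)
  \<comment> \<open>The offset 1 adds exactly the \<open>L\<close> that reflection
    subtracts.\<close>
  have "floor_series lam (- rho) 1 = - A'" "floor_series_left lam (- rho) 1 = - A"
    using floor_series_add_one[OF l, of "- rho" 0] floor_series_left_add_one[OF l, of "- rho" 0]
    by (simp_all add: abc floor_series_minus[OF l] floor_series_left_minus[OF l])
  moreover have "floor_series lam (- rho) alpha = - C' - L" "floor_series_left lam (- rho) alpha = - C - L"
    by (simp_all add: abc L_def floor_series_minus[OF l] floor_series_left_minus[OF l])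
  ultimately have a: "lam * a = L * delta - m * (C' + L) - d * A'"
    and b: "lam * b = L * delta - m * (C + L) - d * A"
    unfolding a_def b_def a_fun_floor_series[OF l al] a_right_floor_series[OF l al] expand
      m_def[symmetric]
    by (simp_all only:) (simp_all add: right_diff_distrib distrib_left)
  have e1: "lam * e1 = lam + m - delta" and e2: "lam * e2 = lam + m + d - delta"
    using l by (simp_all add: e1_def e2_def eta1_def eta2_def m_def)

  \<comment> \<open>By the shift equation, dividing by \<open>lam\<close> moves the offset by
    \<open>rho\<close>; \<open>shift\<close> below makes this explicit.\<close>
  define Ar Ar' Br Br' where "Ar = A / lam" and "Ar' = A' / lam" and "Br = B / lam" and "Br' = B' / lam"
  have over: "A = lam * Ar" "A' = lam * Ar'" "B = lam * Br" "B' = lam * Br'"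
    using l by (simp_all add: Ar_def Ar'_def Br_def Br'_def)
  \<comment> \<open>Since \<open>lam * (1 + L) = L\<close>, each left side is \<open>1 + L\<close>
    times \<open>p - m\<close> or \<open>q - m\<close>; it is written as a sum for use in linear
    arithmetic.\<close>
  have split: "m * Ar + d * Br = p - m + (m * A + d * B)" "m * Ar' + d * Br' = q - m + (m * A' + d * B')"
  proof -
    have *: "m * x + d * y = z - m + (m * (lam * x) + d * (lam * y))"
      if "L * (z - m) = m * (lam * x) + d * (lam * y)" for x y z
    proof -
      have "lam * (m * x + d * y) = L * (z - m)" using that by (simp add: algebra_simps)
      then have "lam * (m * x + d * y) = lam * ((1 + L) * (z - m))"
        using L(2) by (metis mult.assoc)
      then have "m * x + d * y = (1 + L) * (z - m)" using l by simp
      then show ?thesis using that by (simp add: algebra_simps)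
    qed
    show "m * Ar + d * Br = p - m + (m * A + d * B)" "m * Ar' + d * Br' = q - m + (m * A' + d * B')"
      using *[of p Ar Br] *[of q Ar' Br'] p q over by simp_all
  qed
  text \<open>Each gap is expanded at the value \<open>p\<close> or \<open>q\<close> of \<open>delta\<close> that makes it smallest, except that \<open>E2\<close> and
    \<open>E4\<close> are expanded where the gap vanishes if \<open>alpha = 1 - rho\<close>.\<close>
  note lin = p q a b e1 e2 split L(3)
  have E1: "lam * (e1 - a) = m * (C' + L - Ar) + d * (A' + L - Br) + (1 + L) * (p - delta)"
    and E2: "lam * (e1 - a) = m * (C' + L - Ar') + d * (A' + L - Br') - (1 + L) * (delta - q)"
    and E3: "lam * (b - e2) = m * (Ar' - (C + L)) + d * (Br' - 1 - (A + L)) + (1 + L) * (delta - q)"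
    and E4: "lam * (b - e2) = m * (Ar - (C + L)) + d * (Br - 1 - (A + L)) - (1 + L) * (p - delta)"
    and E5: "lam * a = m * (A' - C') + d * (B' - A') + L * (delta - q)"
    and E6: "lam * b = m * (A' - C) + d * (B' - A) + L * (delta - q)"
    and E7: "lam * (1 - a) = m * (C' + L - A) + d * (A' + L - B) + L * (p - delta)"
    and E8: "lam * (1 - b) = m * (C + L - A) + d * (A + L - B) + L * (p - delta)"
    and E9: "lam * (0 - b) = m * (C - A) + d * (A - B) + L * (p - delta)"
    and E10: "lam * (a - b) = m * (C - C') + d * (A - A') + L * 0"
    using lin by (simp_all only: algebra_simps mult_zero_right; linarith)+

  \<comment> \<open>\<open>nonneg\<close> and \<open>pos\<close> read off the sign of a gap from
    three weighted terms; \<open>L * 0\<close> in \<open>E10\<close> and the zero terms in later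
    identities fit this shape.\<close>
  have nonneg: "0 \<le> x" if "lam * x = m * u + d * v + c * w" "0 \<le> u" "0 \<le> v" "0 \<le> w" "0 < c" for x u v w c
    using that m dd l by (metis add_nonneg_nonneg less_imp_le mult_nonneg_nonneg zero_le_mult_iff not_less)
  have pos: "0 < x" if "lam * x = m * u + d * v + c * w" "0 \<le> u" "0 \<le> v" "0 \<le> w" "0 < c"
    and "0 < u \<or> 0 < v \<or> 0 < w" for x u v w c
  proof -
    have "0 \<le> m * u" "0 \<le> d * v" "0 \<le> c * w" "0 < m * u \<or> 0 < d * v \<or> 0 < c * w" using that m dd by auto
    then have "0 < lam * x" using that(1) by linarith
    then show ?thesis using l by (simp add: zero_less_mult_iff)
  qed

  \<comment> \<open>Order of the series values and the range of \<open>delta\<close>\<close>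
  have ineq: "A' \<le> A" "B' \<le> B" "C' \<le> C" "A' \<le> B'" "0 < A'" "A < L\<^sup>2" "B \<le> A + L"
    using mono al one[of 0] floor_series_left_zero_pos[OF l r(1)] floor_series_zero_less[OF l r(2)]
      floor_series_mono[OF l, of alpha 1 rho]
    by (auto simp: abc L_def)
  \<comment> \<open>The integer term vanishes for offset \<open>rho\<close>, but for
    \<open>rho + alpha\<close> it depends on the position relative to 1. This is where the three
    cases for \<open>alpha\<close> against \<open>1 - rho\<close> arise.\<close>
  have shift: "Ar = floor_series lam rho rho" "Ar' = floor_series_left lam rho rho"
    "Br = of_int \<lfloor>rho + alpha\<rfloor> + floor_series lam rho (rho + alpha)"
    "Br' = of_int (\<lceil>rho + alpha\<rceil> - 1) + floor_series_left lam rho (rho + alpha)"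
  proof -
    have "\<lfloor>rho\<rfloor> = 0" "\<lceil>rho\<rceil> = 1" using r by linarith+
    then show "Ar = floor_series lam rho rho" "Ar' = floor_series_left lam rho rho"
      "Br = of_int \<lfloor>rho + alpha\<rfloor> + floor_series lam rho (rho + alpha)"
      "Br' = of_int (\<lceil>rho + alpha\<rceil> - 1) + floor_series_left lam rho (rho + alpha)"
      using l floor_series_shift[OF l, of rho 0] floor_series_left_shift[OF l, of rho 0]
        floor_series_shift[OF l, of rho alpha] floor_series_left_shift[OF l, of rho alpha]
      by (simp_all add: Ar_def Ar'_def Br_def Br'_def abc)
  qed
  have plus: "A + L = floor_series lam rho 1" "A' + L = floor_series_left lam rho 1"
    "C + L = floor_series lam rho (1 - alpha)" "C' + L = floor_series_left lam rho (1 - alpha)"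
    using one[of 0] one[of "- alpha"] by (simp_all add: abc)

  have irr: "A' = A" if "rho \<notin> \<rat>"
  proof -
    have "real (Suc k) * rho + 0 \<notin> \<int>" for k
    proof
      assume "real (Suc k) * rho + 0 \<in> \<int>"
      then obtain n where "rho = of_int n / real (Suc k)"
        by (auto simp: Ints_def field_simps)
      then show False using that by auto
    qed
    then show ?thesis unfolding abc by (rule floor_series_left_eq[OF l])
  qed
  have rat: "b < a" if "rho \<in> \<rat>"
    using pos[OF E10] floor_series_zero_jump[OF l that] ineq L by (simp add: abc)
  have ba: "b \<le> a" using nonneg[OF E10] ineq L by simp

  have "0 < m * A'" "0 \<le> d * B'" using ineq m dd by auto
  then have "0 < L * (q - m)" unfolding q by linarith
  then have D1: "m < delta" using L de by (simp add: zero_less_mult_iff)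
  \<comment> \<open>The bounds \<open>A < L\<^sup>2\<close> and \<open>B < L\<^sup>2 + L\<close>,
    together with \<open>(m + d) * L = lam\<close> and \<open>m + lam + d = 1\<close>, give
    \<open>p < 1\<close>.\<close>
  have LL: "(m + d) * L\<^sup>2 = lam * L" using L(3) by (simp add: power2_eq_square mult.assoc[symmetric])
  have mA: "m * A < m * L\<^sup>2" using ineq m by simp
  have "d * B < d * (L\<^sup>2 + L)" using ineq dd by simp
  then have "L * (p - m) < L * (lam + d)" using mA LL unfolding p by (simp add: algebra_simps)
  then have D2: "delta < 1" using L de by (simp add: m_def)
  have "lam * (e2 - e1) > 0" "lam * (1 - e1) > 0" "lam * e2 > 0"
    using e1 e2 dd D1 D2 by (simp_all add: algebra_simps m_def)
  then have e: "e1 < e2" "e1 < 1" "0 < e2" using l by (simp_all add: zero_less_mult_iff)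

  \<comment> \<open>The offsets satisfy \<open>- alpha < 0 < alpha\<close>, so each left limit in
    \<open>E6\<close> dominates the series value it is compared with.\<close>
  have b0: "0 \<le> b" "rho \<notin> \<rat> \<or> delta \<noteq> q \<Longrightarrow> 0 < b" if "0 < alpha"
  proof -
    have *: "0 \<le> A' - C" "0 \<le> B' - A"
      using mono(4)[of "- alpha" 0] mono(4)[of 0 alpha] that by (simp_all add: abc)
    then show "0 \<le> b" using nonneg[OF E6] de L by simp
    show "0 < b" if "rho \<notin> \<rat> \<or> delta \<noteq> q"
      using pos[OF E6 *] strict[of "- alpha" 0] that \<open>0 < alpha\<close> de L by (auto simp: abc)
  qed
  \<comment> \<open>The offsets compared are \<open>0 < 1 - alpha\<close> and
    \<open>alpha < 1\<close>; adding \<open>L\<close> raises an offset by 1.\<close>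
  have a1: "a \<le> 1" "rho \<notin> \<rat> \<or> delta \<noteq> p \<Longrightarrow> a < 1" if "alpha < 1"
  proof -
    have *: "0 \<le> C' + L - A" "0 \<le> A' + L - B"
      using mono(4)[of 0 "1 - alpha"] mono(4)[of alpha 1] that by (simp_all add: abc plus[unfolded abc])
    then show "a \<le> 1" using nonneg[OF E7] de L by simp
    show "a < 1" if "rho \<notin> \<rat> \<or> delta \<noteq> p"
      using pos[OF E7 *] strict[of 0 "1 - alpha"] that \<open>alpha < 1\<close> de L
      by (auto simp: abc plus[unfolded abc])
  qed

  \<comment> \<open>The three offsets coincide, so only jumps at offset 0 and distances from
    \<open>delta\<close> to its end points remain.\<close>
  have zero: "b \<le> 0" "0 \<le> a" "rho \<notin> \<rat> \<Longrightarrow> a = 0" "rho \<notin> \<rat> \<Longrightarrow> b = 0" if "alpha = 0"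
  proof -
    have eq: "B = A" "C = A" "B' = A'" "C' = A'" using that by (simp_all add: abc)
    show *: "b \<le> 0" "0 \<le> a" using nonneg[OF E9] nonneg[OF E5] eq ineq de L by simp_all
    assume "rho \<notin> \<rat>"
    then have "lam * (a - b) = 0" using E10 eq irr by simp
    then show "a = 0" "b = 0" using * l by auto
  qed
  \<comment> \<open>The three offsets differ by integers, so up to multiples of \<open>L\<close>
    only \<open>A\<close> and \<open>A'\<close> occur.\<close>
  have unit: "b \<le> 1" "1 \<le> a" "delta \<noteq> p \<Longrightarrow> b < 1" "rho \<notin> \<rat> \<Longrightarrow> a = 1" "rho \<notin> \<rat> \<Longrightarrow> b = 1"
    if "alpha = 1"
  proof -
    have eq: "B = A + L" "B' - A' = L" "C + L = A" "A' - C' = L"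
      using plus that by (simp_all add: abc)
    have *: "lam * (a - 1) = m * 0 + d * 0 + L * (delta - q)"
      using E5 L(3) unfolding eq(2,4) by (simp add: algebra_simps)
    show **: "b \<le> 1" "1 \<le> a" using nonneg[OF E8] nonneg[OF *] eq de L by simp_all
    show "b < 1" if "delta \<noteq> p" using pos[OF E8] that eq de L by simp
    assume i: "rho \<notin> \<rat>"
    have "C = C'" using eq irr[OF i] by linarith
    then have "lam * (a - b) = 0" using E10 irr[OF i] by simp
    then show "a = 1" "b = 1" using ** l by auto
  qed

  \<comment> \<open>The three positions of \<open>alpha\<close> relative to
    \<open>1 - rho\<close>\<close>
  have low: "delta < 1 - d" "a \<le> e1" "rho \<notin> \<rat> \<or> delta \<noteq> p \<Longrightarrow> a < e1" "0 < e1" if "alpha < 1 - rho"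
  proof -
    have "\<lfloor>rho + alpha\<rfloor> = 0" using that al r by linarith
    then have Br: "Br = floor_series lam rho (rho + alpha)" using shift by simp
    have *: "0 \<le> C' + L - Ar" "0 \<le> A' + L - Br"
      unfolding plus shift(1) Br using mono(4) that by simp_all
    show "a \<le> e1" using nonneg[OF E1 *] de L by simp
    show "a < e1" if "rho \<notin> \<rat> \<or> delta \<noteq> p"
      using pos[OF E1 *] strict[of rho "1 - alpha"] that \<open>alpha < 1 - rho\<close> de L
      by (auto simp: plus shift(1))
    \<comment> \<open>Rescaling by \<open>lam * (1 + L) = L\<close> turns this into
      \<open>B < L\<^sup>2\<close>, sharper than the general bound by \<open>L\<close>; this lowers
      the bound for \<open>delta\<close> from 1 to \<open>1 - d\<close>.\<close>
    have "Br < L\<^sup>2 + L" using * ineq by linarith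
    then have "lam * Br < lam * (L\<^sup>2 + L)" using l by simp
    also have "\<dots> = lam * (1 + L) * L" by (simp add: power2_eq_square algebra_simps)
    finally have "d * B < d * L\<^sup>2" using over L(2) dd by (simp add: power2_eq_square)
    then have "L * (p - m) < L * lam" using mA LL unfolding p by (simp add: algebra_simps)
    then show 1: "delta < 1 - d" using L de by (simp add: m_def)
    have "0 < lam * e1" using e1 1 by (simp add: m_def)
    then show "0 < e1" using l by (simp add: zero_less_mult_iff)
  qed
  have high: "1 - lam < delta" "e2 \<le> b" "rho \<notin> \<rat> \<or> delta \<noteq> q \<Longrightarrow> e2 < b" "e2 < 1" if "1 - rho < alpha"
  proof -
    have "\<lceil>rho + alpha\<rceil> = 2" using that al r by linarith
    then have Br': "Br' = 1 + floor_series_left lam rho (rho + alpha)" using shift by simp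
    have *: "0 \<le> Ar' - (C + L)" "0 \<le> Br' - 1 - (A + L)"
      unfolding plus shift(2) Br' using mono(4) that by simp_all
    show "e2 \<le> b" using nonneg[OF E3 *] de L by simp
    show "e2 < b" if "rho \<notin> \<rat> \<or> delta \<noteq> q"
      using pos[OF E3 *] strict[of "1 - alpha" rho] that \<open>1 - rho < alpha\<close> de L
      by (auto simp: plus shift(2))
    \<comment> \<open>The 1 comes from the ceiling 2 of \<open>rho + alpha\<close>; after rescaling,
      \<open>L \<le> B'\<close>, which forces \<open>q - m > d\<close>.\<close>
    have "1 + L \<le> Br'" using * ineq by linarith
    then have "lam * (1 + L) \<le> lam * Br'" using l by simp
    then have "d * L \<le> d * B'" using over L(2) dd by simp
    then have "L * d < L * (q - m)" unfolding q using \<open>0 < m * A'\<close> by (simp add: mult.commute)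
    then show 1: "1 - lam < delta" using L de by (simp add: m_def)
    have "lam * e2 < lam * 1" using e2 1 by (simp add: m_def)
    then show "e2 < 1" using l by simp
  qed
  have mid: "e1 \<le> a" "a = e1 \<longleftrightarrow> delta = q" "b \<le> e2" "b = e2 \<longleftrightarrow> delta = p" "rho \<notin> \<rat> \<Longrightarrow> b = a"
    if "alpha = 1 - rho"
  proof -
    \<comment> \<open>As \<open>rho + alpha = 1\<close>, the shifted offsets are those of
      \<open>plus\<close>. The series parts of \<open>E2\<close> and \<open>E4\<close> cancel and
      only the distance from \<open>delta\<close> to an end point remains, hence the
      equivalences.\<close>
    have sh: "Br = 1 + (A + L)" "Br' = A' + L" "C + L = Ar" "C' + L = Ar'"
      using shift plus that by simp_all
    have *: "lam * (a - e1) = m * 0 + d * 0 + (1 + L) * (delta - q)"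
      "lam * (e2 - b) = m * 0 + d * 0 + (1 + L) * (p - delta)"
      using E2 E4 sh by (simp_all add: algebra_simps)
    show "e1 \<le> a" "b \<le> e2" using nonneg[OF *(1)] nonneg[OF *(2)] de L by simp_all
    show "a = e1 \<longleftrightarrow> delta = q" using *(1) l L by auto
    show "b = e2 \<longleftrightarrow> delta = p" using *(2) l L by auto
    assume i: "rho \<notin> \<rat>"
    have "Ar = Ar'" using irr[OF i] over l by simp
    then have "lam * (a - b) = 0" using E10 sh irr[OF i] by simp
    then show "b = a" using l by simp
  qed

  \<comment> \<open>Membership in \<open>M1\<close>, \<open>M2\<close> and \<open>M3\<close>\<close>
  have ends: "0 < alpha" if "alpha \<noteq> 0" using that al by simp
  have ends1: "alpha < 1" if "alpha \<noteq> 1" using that al by simp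
  have M: "(delta, x) \<in> M1 lam d \<longleftrightarrow> m < delta \<and> delta < 1 - d \<and> 0 \<le> x \<and> x < e1"
    "(delta, x) \<in> M2 lam d \<longleftrightarrow> 0 \<le> x \<and> x \<le> 1 \<and> e1 \<le> x \<and> x \<le> e2"
    "(delta, x) \<in> M3 lam \<longleftrightarrow> 1 - lam < delta \<and> e2 < x \<and> x \<le> 1" for x
    using D1 D2 by (auto simp: M1_def M2_def M3_def e1_def e2_def m_def)
  have witness: "\<exists>x\<in>{b..a}. (alpha \<in> {0..<1 - rho} \<longrightarrow> (delta, x) \<in> M1 lam d) \<and>
      (alpha = 1 - rho \<longrightarrow> (delta, x) \<in> M2 lam d) \<and>
      (alpha \<in> {1 - rho<..1} \<longrightarrow> (delta, x) \<in> M3 lam)" if "rho \<in> \<rat>"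
  proof -
    consider "alpha < 1 - rho" "alpha = 0" | "alpha < 1 - rho" "0 < alpha" | "alpha = 1 - rho"
      | "1 - rho < alpha" "alpha = 1" | "1 - rho < alpha" "alpha < 1"
      using al by linarith
    then show ?thesis
    proof cases
      case 1
      then show ?thesis using zero low D1 by (intro bexI[of _ 0]) (auto simp: M)
    next
      case 2
      \<comment> \<open>For rational \<open>rho\<close> the jump gives \<open>b < a\<close>, hence
        \<open>b < e1\<close> even if \<open>a = e1\<close>.\<close>
      then show ?thesis using b0 low D1 rat[OF that] by (intro bexI[of _ b]) (auto simp: M)
    next
      case 3
      \<comment> \<open>The larger of the two lower ends lies in both intervals, since
        \<open>e1 \<le> a\<close>, \<open>b \<le> e2\<close>, \<open>b \<le> a\<close> and
        \<open>e1 < e2\<close>.\<close>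
      then show ?thesis using b0 a1 mid e ba r by (intro bexI[of _ "max b e1"]) (auto simp: M)
    next
      case 4
      then show ?thesis using unit high by (intro bexI[of _ 1]) (auto simp: M)
    next
      case 5
      then show ?thesis using a1 high rat[OF that] by (intro bexI[of _ a]) (auto simp: M)
    qed
  qed

  \<comment> \<open>For irrational \<open>rho\<close> the strict bounds in \<open>low\<close> and
    \<open>high\<close> hold for every admissible \<open>delta\<close>, so the end points of the
    interval qualify too.\<close>
  have irrational: "(alpha \<in> {0..<1 - rho} \<longrightarrow> (delta, x) \<in> M1 lam d) \<and>
      (alpha = 1 - rho \<longrightarrow> (delta, x) \<in> M2 lam d) \<and>
      (alpha \<in> {1 - rho<..1} \<longrightarrow> (delta, x) \<in> M3 lam)" if "rho \<notin> \<rat>" "x \<in> {b..a}" for x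
  proof (intro conjI impI)
    assume h: "alpha \<in> {0..<1 - rho}"
    have "0 \<le> b"
    proof (cases "alpha = 0")
      case True
      then show ?thesis using zero that(1) by simp
    next
      case False
      then show ?thesis using b0(1) ends by blast
    qed
    then show "(delta, x) \<in> M1 lam d" using h that low(1) low(3) D1 by (auto simp: M)
  next
    assume "alpha = 1 - rho"
    then show "(delta, x) \<in> M2 lam d" using that mid(1,3,5) b0(1) a1(1) r by (auto simp: M)
  next
    assume h: "alpha \<in> {1 - rho<..1}"
    have "a \<le> 1"
    proof (cases "alpha = 1")
      case True
      then show ?thesis using unit that(1) by simp
    next
      case False
      then show ?thesis using a1(1) ends1 by blast
    qed
    then show "(delta, x) \<in> M3 lam" using h that high(1) high(3) by (auto simp: M)
  qed

  show ?thesis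
    unfolding p_def[symmetric] q_def[symmetric] a_def[symmetric] b_def[symmetric]
      e1_def[symmetric] e2_def[symmetric] m_def[symmetric]
  proof (intro conjI)
    show "rho \<notin> \<rat> \<longrightarrow> (\<forall>x\<in>{b..a}. (alpha \<in> {0..<1 - rho} \<longrightarrow> (delta, x) \<in> M1 lam d) \<and>
        (alpha = 1 - rho \<longrightarrow> (delta, x) \<in> M2 lam d) \<and>
        (alpha \<in> {1 - rho<..1} \<longrightarrow> (delta, x) \<in> M3 lam))"
      using irrational by blast
    show "rho \<in> \<rat> \<longrightarrow> (\<exists>x\<in>{b..a}. (alpha \<in> {0..<1 - rho} \<longrightarrow> (delta, x) \<in> M1 lam d) \<and>
        (alpha = 1 - rho \<longrightarrow> (delta, x) \<in> M2 lam d) \<and>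
        (alpha \<in> {1 - rho<..1} \<longrightarrow> (delta, x) \<in> M3 lam))"
      using witness by blast
  next
    show "alpha \<in> {0..<1 - rho} \<longrightarrow>
        delta \<in> {m<..<1 - d} \<and>
        (alpha \<noteq> 0 \<longrightarrow>
           {b .. a} \<subseteq> {0..e1} \<and>
           (b = 0 \<longrightarrow> rho \<in> \<rat> \<and> delta = q) \<and>
           (a = e1 \<longrightarrow> rho \<in> \<rat> \<and> delta = p)) \<and>
        (alpha = 0 \<longrightarrow>
           (rho \<notin> \<rat> \<longrightarrow> b = a \<and> a = 0) \<and>
           (rho \<in> \<rat> \<longrightarrow>
              b \<le> 0 \<and> 0 \<le> a \<and> a \<le> e1 \<and>
              (delta \<noteq> p \<longrightarrow> a < e1)))" (is "_ \<longrightarrow> ?P")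
    proof (rule impI)
      assume "alpha \<in> {0..<1 - rho}"
      then have h: "alpha < 1 - rho" by simp
      show ?P
        using low[OF h] D1 b0[OF ends] zero by (cases "alpha = 0") auto
    qed
  next
    show "alpha \<in> {1 - rho<..1} \<longrightarrow>
        delta \<in> {1 - lam<..<1} \<and>
        (alpha \<noteq> 1 \<longrightarrow>
           {b .. a} \<subseteq> {e2..1} \<and>
           (b = e2 \<longrightarrow> rho \<in> \<rat> \<and> delta = q) \<and>
           (a = 1 \<longrightarrow> rho \<in> \<rat> \<and> delta = p)) \<and>
        (alpha = 1 \<longrightarrow>
           (rho \<notin> \<rat> \<longrightarrow> b = a \<and> a = 1) \<and>
           (rho \<in> \<rat> \<longrightarrow>
              e2 \<le> b \<and> b \<le> 1 \<and> 1 \<le> a \<and>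
              (delta \<noteq> q \<longrightarrow> e2 < b) \<and>
              (delta \<noteq> p \<longrightarrow> b < 1)))" (is "_ \<longrightarrow> ?P")
    proof (rule impI)
      assume "alpha \<in> {1 - rho<..1}"
      then have h: "1 - rho < alpha" by simp
      show ?P
        using high[OF h] D2 a1[OF ends1] unit by (cases "alpha = 1") auto
    qed
  next
    have "{b..a} \<inter> {e1..e2} \<noteq> {}" if "alpha = 1 - rho"
    proof -
      have "max b e1 \<in> {b..a} \<inter> {e1..e2}" using mid[OF that] ba e by auto
      then show ?thesis by blast
    qed
    then show "alpha = 1 - rho \<longrightarrow> delta \<in> {m<..<1} \<and>
        (rho \<notin> \<rat> \<longrightarrow> b = a \<and> a \<in> {e1..e2}) \<and>
        (rho \<in> \<rat> \<longrightarrow> {b..a} \<inter> {e1..e2} \<noteq> {}) \<and>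
        (a = e1 \<longleftrightarrow> delta = q) \<and> (b = e2 \<longleftrightarrow> delta = p)"
      using D1 D2 mid by auto
  qed
qed

end
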